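(* Let $\eta$ be a finite Borel measure on $[0,1)$. Then, for every $a$ in $[0,1)$, $$\beta_\eta(a)=(1-a^2)^2\sum_{n=0}^\infty (n+1)\,a^{2n}\,\gamma_\eta(n).$$
   Context: Measures are positive, and $\mathbb{N}_0=\{0,1,2,\ldots\}$. For a finite Borel measure $\eta$ on $[0,1)$: $\beta_\eta(a)=2(1-a^2)^2\int_{[0,1)}\frac{1+a^2r^2}{(1-a^2r^2)^3}\,\mathrm{d}\eta(r)$ for $a\in[0,1)$, and $\gamma_\eta(k)=2(k+1)\int_{[0,1)}r^{2k}\,\mathrm{d}\eta(r)$ for $k\in\mathbb{N}_0$. Convention: $0^0=1$. *)

theory Defs
  imports "HOL-Analysis.Analysis"
begin

text \<open>A Borel measure on the half-open interval \<open>[0,1)\<close> is a measure whose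
  sigma-algebra is the Borel sigma-algebra of the subspace; its underlying space is then
  \<open>{0..<1}\<close>, so the integrals below range over \<open>[0,1)\<close>.\<close>

definition finite_borel_measure_01 :: "real measure \<Rightarrow> bool" where
  "finite_borel_measure_01 \<eta> \<longleftrightarrow>
     sets \<eta> = sets (restrict_space borel {0..<1::real}) \<and> finite_measure \<eta>"

text \<open>For a finite measure on \<open>[0,1)\<close>, both integrands are bounded and measurable (when
  \<open>0 \<le> a < 1\<close> in the first case), so the Bochner integrals are genuine. The convention
  \<open>0 ^ 0 = 1\<close> is that of the library.\<close>

definition beta :: "real measure \<Rightarrow> real \<Rightarrow> real" where
  "beta \<eta> a = 2 * (1 - a\<^sup>2)\<^sup>2 *
     (\<integral>r. (1 + a\<^sup>2 * r\<^sup>2) / (1 - a\<^sup>2 * r\<^sup>2) ^ 3 \<partial>\<eta>)"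

definition gamma :: "real measure \<Rightarrow> nat \<Rightarrow> real" where
  "gamma \<eta> k = 2 * (real k + 1) * (\<integral>r. r ^ (2 * k) \<partial>\<eta>)"

end

theory Submission
  imports Defs
begin

text \<open>The claim comes from integrating \<open>(1 + x) / (1 - x)\<^sup>3 = \<Sum>n. (n + 1)\<^sup>2 x\<^sup>n\<close> at
  \<open>x = a\<^sup>2 r\<^sup>2\<close> term by term, with the summable majorant \<open>(n + 1)\<^sup>2 a\<^sup>2\<^sup>n\<close> on \<open>[0,1)\<close>.\<close>

text \<open>Termwise differentiation of \<open>z / (1 - z)\<^sup>2 = (\<Sum>n. n * z ^ n)\<close>
  inside the unit disc; the derivative of the left-hand side is
  \<open>(1 + z) / (1 - z) ^ 3\<close>.\<close>

lemma sums_Suc_squared_mult_power: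
  fixes x :: "'a::{real_normed_field,banach}"
  assumes "norm x < 1"
  shows "(\<lambda>n. (of_nat n + 1)\<^sup>2 * x ^ n) sums ((1 + x) / (1 - x) ^ 3)"
proof -
  have first: "(\<lambda>n. of_nat n * z ^ n) sums (z / (1 - z)\<^sup>2)" if "norm z < 1" for z :: 'a
  proof -
    have "(\<lambda>n. z * (of_nat (Suc n) * z ^ n)) sums (z * (1 / (1 - z)\<^sup>2))"
      using geometric_deriv_sums[OF that] by (rule sums_mult)
    then have "(\<lambda>n. of_nat (Suc n) * z ^ Suc n) sums (z / (1 - z)\<^sup>2)"
      by (simp add: mult_ac)
    \<comment> \<open>The index shift leaves the sum unchanged, because the term at
      \<open>n = 0\<close> vanishes.\<close>
    then show ?thesis
      using sums_Suc_iff[of "\<lambda>n. of_nat n * z ^ n" "z / (1 - z)\<^sup>2"] by simp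
  qed
  have x: "x \<noteq> 1"
    using assms by auto
  \<comment> \<open>\<open>diffs c n\<close> is \<open>(n + 1) * c (n + 1)\<close>: one factor
    \<open>n + 1\<close> comes from differentiating, the other is the coefficient itself.\<close>
  have diffs: "diffs of_nat n = (of_nat n + 1 :: 'a)\<^sup>2" for n
    by (simp add: diffs_def power2_eq_square add.commute)
  have "((\<lambda>z. z / (1 - z)\<^sup>2) has_field_derivative ((1 + x) / (1 - x) ^ 3)) (at x)"
    using x by (auto intro!: derivative_eq_intros
        simp: divide_simps power2_eq_square power3_eq_cube) (simp add: algebra_simps)
  from termdiffs_sums_strong[OF first this assms] show ?thesis
    by (simp add: diffs)
qed

theorem proposition4p4:
  fixes \<eta> :: "real measure"
  assumes "finite_borel_measure_01 \<eta>"
  shows "\<forall>a\<in>{0..<1::real}.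
    summable (\<lambda>n. (real n + 1) * a ^ (2 * n) * gamma \<eta> n) \<and>
    beta \<eta> a = (1 - a\<^sup>2)\<^sup>2 * (\<Sum>n. (real n + 1) * a ^ (2 * n) * gamma \<eta> n)"
proof
  fix a :: real
  assume a: "a \<in> {0..<1}"
  have sets: "sets \<eta> = sets (restrict_space borel {0..<1})"
    using assms by (simp add: finite_borel_measure_01_def)
  interpret finite_measure \<eta>
    using assms by (simp add: finite_borel_measure_01_def)
  have space: "space \<eta> = {0..<1}"
    using sets_eq_imp_space_eq[OF sets] by (simp add: space_restrict_space)
  have meas: "(\<lambda>r. r ^ k) \<in> borel_measurable \<eta>" for k :: nat
    unfolding measurable_cong_sets[OF sets refl]
    by (intro measurable_restrict_space1) measurable
  have pow_int: "integrable \<eta> (\<lambda>r. r ^ k)" for k :: nat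
    by (rule integrable_const_bound[OF _ meas, of _ 1])
       (auto simp: space power_le_one)
  have a2: "norm (a\<^sup>2) < 1"
    using a by (simp add: power_less_one_iff abs_square_less_1)
  \<comment> \<open>The powers of \<open>a\<close> and \<open>r\<close> are kept apart, so that each
    term is a constant times a moment integrand of \<open>gamma\<close>.\<close>
  define f where "f n r = (real n + 1)\<^sup>2 * (a\<^sup>2) ^ n * r ^ (2 * n)" for n r
  have f_int: "integrable \<eta> (f n)" for n
    unfolding f_def by (intro integrable_mult_right pow_int)
  have f_sums: "(\<lambda>n. f n r) sums ((1 + a\<^sup>2 * r\<^sup>2) / (1 - a\<^sup>2 * r\<^sup>2) ^ 3)"
    if "r \<in> space \<eta>" for r
  proof -
    \<comment> \<open>The product is \<open>(a * r)\<^sup>2\<close>, and \<open>a * r < 1\<close>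
      since both factors lie in \<open>[0,1)\<close>.\<close>
    have "norm (a\<^sup>2 * r\<^sup>2) < 1"
      using a that mult_strict_mono[of a 1 r 1] unfolding space
      by (simp add: abs_square_less_1 abs_mult flip: power_mult_distrib)
    from sums_Suc_squared_mult_power[OF this] show ?thesis
      by (simp add: f_def power_mult_distrib mult_ac flip: power_mult)
  qed
  have f_nonneg: "0 \<le> f n r" for n r
    by (simp add: f_def power_mult)
  \<comment> \<open>The majorant is the series of the lemma at \<open>x = a\<^sup>2\<close>, scaled
    by the total mass of \<open>\<eta>\<close>; it dominates because
    \<open>r ^ (2 * n) \<le> 1\<close> on \<open>[0,1)\<close>.\<close>
  have "summable (\<lambda>n. (real n + 1)\<^sup>2 * (a\<^sup>2) ^ n * measure \<eta> (space \<eta>))"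
    using sums_summable[OF sums_Suc_squared_mult_power[OF a2]] by (intro summable_mult2) simp
  moreover have "norm (\<integral>r. norm (f n r) \<partial>\<eta>) \<le> (real n + 1)\<^sup>2 * (a\<^sup>2) ^ n * measure \<eta> (space \<eta>)"
    for n
  proof -
    have "(\<integral>r. f n r \<partial>\<eta>) \<le> (\<integral>r. (real n + 1)\<^sup>2 * (a\<^sup>2) ^ n \<partial>\<eta>)"
      by (intro integral_mono f_int)
         (auto simp: f_def space intro!: mult_left_le power_le_one)
    then show ?thesis
      using f_nonneg by (simp add: mult_ac)
  qed
  ultimately have norm_sum: "summable (\<lambda>n. \<integral>r. norm (f n r) \<partial>\<eta>)"
    by (rule summable_comparison_test'[where N = 0])
  \<comment> \<open>Exchanging sum and integral requires absolute summability at each point; as the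
    terms are nonnegative, \<open>f_sums\<close> provides it.\<close>
  have "(\<lambda>n. \<integral>r. f n r \<partial>\<eta>) sums (\<integral>r. (\<Sum>n. f n r) \<partial>\<eta>)"
    by (intro sums_integral f_int norm_sum AE_I2) (use f_sums f_nonneg in \<open>auto simp: sums_iff\<close>)
  also have "(\<integral>r. (\<Sum>n. f n r) \<partial>\<eta>) = (\<integral>r. (1 + a\<^sup>2 * r\<^sup>2) / (1 - a\<^sup>2 * r\<^sup>2) ^ 3 \<partial>\<eta>)"
    using f_sums by (intro Bochner_Integration.integral_cong) (auto simp: sums_iff)
  finally have "(\<lambda>n. 2 * (\<integral>r. f n r \<partial>\<eta>)) sums
      (2 * (\<integral>r. (1 + a\<^sup>2 * r\<^sup>2) / (1 - a\<^sup>2 * r\<^sup>2) ^ 3 \<partial>\<eta>))"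
    by (rule sums_mult)
  \<comment> \<open>Of the two factors \<open>n + 1\<close> in \<open>f\<close>, one is absorbed by
    \<open>gamma\<close> together with the 2.\<close>
  moreover have "2 * (\<integral>r. f n r \<partial>\<eta>) = (real n + 1) * a ^ (2 * n) * gamma \<eta> n" for n
    by (simp add: f_def gamma_def power_mult power2_eq_square)
  ultimately show "summable (\<lambda>n. (real n + 1) * a ^ (2 * n) * gamma \<eta> n) \<and>
      beta \<eta> a = (1 - a\<^sup>2)\<^sup>2 * (\<Sum>n. (real n + 1) * a ^ (2 * n) * gamma \<eta> n)"
    by (simp add: beta_def sums_iff)
qed

end
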